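(* Let $\mu,\nu\in P_1(\mathbb{R}^d)$. Assume that $\|\cdot\|$ is a norm on $\mathbb{R}^d$ and $c(x,y)=\|x-y\|$. Then $$D_c(\mu,P_{\leqslant\nu})=D_c(P_{\mu\leqslant},\nu)=\sup\left\{\int_{\mathbb{R}^d}\varphi\,d(\mu-\nu):\ \varphi\in\mathcal{A},\ \varphi\text{ is }1\text{-Lipschitz with respect to }\|\cdot\|\right\}.$$ The supremum is attained by some convex function that is $1$-Lipschitz with respect to $\|\cdot\|$.
   Context: $P_1(\mathbb{R}^d)$ is the set of Borel probability measures on $\mathbb{R}^d$ with finite first moment. $\mathcal{A}$ is the set of real-valued convex functions on $\mathbb{R}^d$. $C_{b,1}$ is the set of continuous $f:\mathbb{R}^d\to\mathbb{R}$ such that $f(x)/(1+|x|)$ is bounded. Transforms: $Q_c(\varphi)(x)=\inf_{y}\{\varphi(y)+c(x,y)\}$, $Q_{\bar c}(\psi)(y)=\sup_{x}\{\psi(x)-c(x,y)\}$. Dual problems of the Wasserstein projections in convex order: $D_c(\mu,P_{\leqslant\nu})=\sup_{\varphi\in\mathcal{A}\cap C_{b,1}}\{\int Q_c(\varphi)d\mu-\int\varphi\,d\nu\}$ and $D_c(P_{\mu\leqslant},\nu)=\sup_{\psi\in\mathcal{A}\cap C_{b,1}}\{\int\psi\,d\mu-\int Q_{\bar c}(\psi)d\nu\}$. Here $P_{\leqslant\nu}$, $P_{\mu\leqslant}$ denote the sets of measures in $P_1(\mathbb{R}^d)$ that are respectively dominated by $\nu$ and dominating $\mu$ in the convex order.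 *)

theory Defs
  imports "HOL-Probability.Probability"
begin

definition is_norm :: "('a::real_vector \<Rightarrow> real) \<Rightarrow> bool" where
  "is_norm N \<longleftrightarrow>
     (\<forall>x. 0 \<le> N x) \<and> (\<forall>x. N x = 0 \<longleftrightarrow> x = 0) \<and>
     (\<forall>a x. N (a *\<^sub>R x) = \<bar>a\<bar> * N x) \<and>
     (\<forall>x y. N (x + y) \<le> N x + N y)"

definition P1 :: "'a::euclidean_space measure set" where
  "P1 = {M. prob_space M \<and> sets M = sets borel \<and> integrable M norm}"

definition convex_functions :: "('a::euclidean_space \<Rightarrow> real) set" where
  "convex_functions = {f. convex_on UNIV f}"

definition C_b1 :: "('a::euclidean_space \<Rightarrow> real) set" where
  "C_b1 = {f. continuous_on UNIV f \<and> bounded (range (\<lambda>x. f x / (1 + norm x)))}"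

text \<open>The transforms are extended-real valued: the infimum may be \<open>-\<infinity>\<close>, the supremum \<open>\<infinity>\<close>.\<close>

definition Q_c :: "('a \<Rightarrow> 'a \<Rightarrow> real) \<Rightarrow> ('a \<Rightarrow> real) \<Rightarrow> 'a \<Rightarrow> ereal" where
  "Q_c c \<phi> x = (INF y. ereal (\<phi> y + c x y))"

definition Q_cbar :: "('a \<Rightarrow> 'a \<Rightarrow> real) \<Rightarrow> ('a \<Rightarrow> real) \<Rightarrow> 'a \<Rightarrow> ereal" where
  "Q_cbar c \<psi> y = (SUP x. ereal (\<psi> x - c x y))"

text \<open>Integral of an extended-real valued function as the integral of its positive part minus that
  of its negative part; \<^const>\<open>e2ennreal\<close> maps negative values to 0.  It is meaningful when the two
  parts do not both have integral \<open>\<infinity>\<close>.  This holds in the two dual problems below whenever the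
  measures lie in \<^const>\<open>P1\<close> and \<open>c\<close> vanishes on the diagonal, since then \<open>Q_c c \<phi> \<le> \<phi>\<close>
  and \<open>\<psi> \<le> Q_cbar c \<psi>\<close>.\<close>

definition ereal_integral :: "'a measure \<Rightarrow> ('a \<Rightarrow> ereal) \<Rightarrow> ereal" where
  "ereal_integral M f =
     enn2ereal (\<integral>\<^sup>+x. e2ennreal (f x) \<partial>M) - enn2ereal (\<integral>\<^sup>+x. e2ennreal (- f x) \<partial>M)"

text \<open>The dual problems of projecting \<open>\<mu>\<close> onto the measures dominated by \<open>\<nu>\<close> in convex order,
  and of projecting \<open>\<nu>\<close> onto the measures dominating \<open>\<mu>\<close>.\<close>

definition D_c_below ::
  "('a \<Rightarrow> 'a \<Rightarrow> real) \<Rightarrow> 'a::euclidean_space measure \<Rightarrow> 'a measure \<Rightarrow> ereal" where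
  "D_c_below c \<mu> \<nu> =
     (SUP \<phi>\<in>convex_functions \<inter> C_b1. ereal_integral \<mu> (Q_c c \<phi>) - ereal (\<integral>x. \<phi> x \<partial>\<nu>))"

definition D_c_above ::
  "('a \<Rightarrow> 'a \<Rightarrow> real) \<Rightarrow> 'a::euclidean_space measure \<Rightarrow> 'a measure \<Rightarrow> ereal" where
  "D_c_above c \<mu> \<nu> =
     (SUP \<psi>\<in>convex_functions \<inter> C_b1. ereal (\<integral>x. \<psi> x \<partial>\<mu>) - ereal_integral \<nu> (Q_cbar c \<psi>))"

definition lipschitz1_wrt :: "('a::real_vector \<Rightarrow> real) \<Rightarrow> ('a \<Rightarrow> real) \<Rightarrow> bool" where
  "lipschitz1_wrt N f \<longleftrightarrow> (\<forall>x y. \<bar>f x - f y\<bar> \<le> N (x - y))"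

end

theory Submission
  imports Defs "HOL-Complex_Analysis.Great_Picard"
begin

text \<open>For \<open>c x y = N (x - y)\<close> the transform \<open>Q_c c \<phi>\<close> is either identically \<open>-\<infinity>\<close> or a convex,
  1-Lipschitz minorant of \<open>\<phi>\<close>; in the latter case it improves on \<open>\<phi>\<close> in both integrals of the dual
  problem.  Symmetrically \<open>Q_cbar c \<psi>\<close> is identically \<open>\<infinity>\<close> or a convex, 1-Lipschitz majorant of
  \<open>\<psi>\<close>.  Since both transforms fix 1-Lipschitz functions, the dual problems reduce to convex
  1-Lipschitz functions.  The functional ignores additive constants, so a maximising sequence may be
  taken to vanish at the origin; it is then dominated by \<open>N\<close>, and an Arzela-Ascoli argument with
  dominated convergence yields a maximiser.\<close>

section \<open>Norms, Lipschitz functions and integration against measures with finite first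
  moment\<close>

lemma is_normD:
  assumes "is_norm N"
  shows "0 \<le> N x" "N 0 = 0" "N (a *\<^sub>R x) = \<bar>a\<bar> * N x" "N (x + y) \<le> N x + N y"
  using assms by (auto simp: is_norm_def)

lemma is_norm_uminus: "is_norm N \<Longrightarrow> N (- x) = N x"
  using is_normD(3)[of N "-1" x] by simp

lemma is_norm_minus_commute: "is_norm N \<Longrightarrow> N (x - y) = N (y - x)"
  using is_norm_uminus[of N "x - y"] by simp

lemma is_norm_triangle: "is_norm N \<Longrightarrow> N (x - z) \<le> N (x - y) + N (y - z)"
  using is_normD(4)[of N "x - y" "y - z"] by simp

text \<open>Expand \<open>x\<close> in the orthonormal basis and bound each coordinate by
  \<open>norm x\<close>. The comparison turns 1-Lipschitz for \<open>N\<close> into Lipschitz for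
  the Euclidean norm, from which continuity and linear growth follow.\<close>

lemma is_norm_le_norm:
  fixes N :: "'a::euclidean_space \<Rightarrow> real"
  assumes "is_norm N"
  obtains C where "0 < C" "\<And>x. N x \<le> C * norm x"
proof -
  \<comment> \<open>The summand 1 gives \<open>0 < C\<close> from nonnegativity of the sum
    alone.\<close>
  define C where "C = 1 + (\<Sum>b\<in>Basis. N b)"
  have "N x \<le> C * norm x" for x
  proof -
    have "N (\<Sum>b\<in>B. (x \<bullet> b) *\<^sub>R b) \<le> (\<Sum>b\<in>B. \<bar>x \<bullet> b\<bar> * N b)" if "finite B" for B
      using that
    proof induction
      case (insert b B)
      then show ?case
        using is_normD(3)[OF assms, of "x \<bullet> b" b]
          is_normD(4)[OF assms, of "(x \<bullet> b) *\<^sub>R b" "\<Sum>b\<in>B. (x \<bullet> b) *\<^sub>R b"] by simp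
    qed (simp add: is_normD[OF assms])
    from this[OF finite_Basis] have "N x \<le> (\<Sum>b\<in>Basis. \<bar>x \<bullet> b\<bar> * N b)"
      by (simp add: euclidean_representation)
    also have "\<dots> \<le> (\<Sum>b\<in>Basis. norm x * N b)"
      by (intro sum_mono mult_right_mono Basis_le_norm is_normD[OF assms])
    also have "\<dots> \<le> C * norm x"
      by (simp add: C_def distrib_right flip: sum_distrib_left)
    finally show ?thesis .
  qed
  moreover have "0 < C"
    unfolding C_def by (intro add_pos_nonneg sum_nonneg is_normD[OF assms]) simp
  ultimately show ?thesis using that by blast
qed

lemma is_norm_continuous_on:
  fixes N :: "'a::euclidean_space \<Rightarrow> real"
  assumes "is_norm N" "lipschitz1_wrt N f"
  shows "continuous_on A f"
proof -
  obtain C where C: "0 < C" "\<And>x. N x \<le> C * norm x"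
    using is_norm_le_norm[OF assms(1)] by blast
  have "C-lipschitz_on A f"
    using assms(2) C order_trans
    by (intro lipschitz_onI) (fastforce simp: lipschitz1_wrt_def dist_norm)+
  then show ?thesis by (rule lipschitz_on_continuous_on)
qed

text \<open>Places \<open>N\<close> itself among the 1-Lipschitz functions, so that it is integrable
  against every measure in \<open>P1\<close> and can later serve as the dominating function.\<close>

lemma lipschitz1_wrt_norm: "is_norm N \<Longrightarrow> lipschitz1_wrt N N"
  unfolding lipschitz1_wrt_def
  using is_norm_triangle[of N _ 0] is_norm_minus_commute[of N]
  by (smt (verit, ccfv_threshold) diff_zero)

text \<open>Comparison with the value at the origin gives linear growth. Hence convex 1-Lipschitz
  functions are admissible in both dual problems.\<close>

lemma lipschitz1_wrt_C_b1:
  fixes N :: "'a::euclidean_space \<Rightarrow> real"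
  assumes "is_norm N" "lipschitz1_wrt N f"
  shows "f \<in> C_b1"
proof -
  obtain C where C: "0 < C" "\<And>x. N x \<le> C * norm x"
    using is_norm_le_norm[OF assms(1)] by blast
  have "\<bar>f x / (1 + norm x)\<bar> \<le> \<bar>f 0\<bar> + C" for x
  proof -
    have "\<bar>f x\<bar> \<le> \<bar>f 0\<bar> + N x"
      using assms(2)[unfolded lipschitz1_wrt_def, rule_format, of x 0] by simp
    also have "\<dots> \<le> (\<bar>f 0\<bar> + C) * (1 + norm x)"
      using C(1) C(2)[of x] by (simp add: algebra_simps add_increasing add_increasing2)
    finally show ?thesis
      by (simp add: field_simps abs_if add_pos_nonneg split: if_splits)
  qed
  then show ?thesis
    using is_norm_continuous_on[OF assms, of UNIV] by (auto simp: C_b1_def bounded_iff)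
qed

text \<open>Such a function is dominated by a multiple of \<open>1 + norm x\<close>, which the
  finite first moment makes integrable.\<close>

lemma integrable_C_b1:
  fixes f :: "'a::euclidean_space \<Rightarrow> real"
  assumes M: "M \<in> P1" and f: "f \<in> C_b1"
  shows "integrable M f"
proof -
  interpret prob_space M using M by (simp add: P1_def)
  obtain B where B: "\<And>x. \<bar>f x / (1 + norm x)\<bar> \<le> B"
    using f by (auto simp: C_b1_def bounded_iff)
  have "integrable M (\<lambda>x. B * (1 + norm x))"
    using M by (auto simp: P1_def)
  moreover have "f \<in> borel_measurable M"
    using f M borel_measurable_continuous_onI[of f] measurable_cong_sets[of M borel borel borel]
    by (auto simp: C_b1_def P1_def)
  moreover have "\<bar>f x\<bar> \<le> B * (1 + norm x)" for x
    using B[of x] by (simp add: abs_divide pos_divide_le_eq add_pos_nonneg)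
  then have "AE x in M. norm (f x) \<le> norm (B * (1 + norm x))"
    by (intro AE_I2) (metis abs_ge_self order_trans real_norm_def)
  ultimately show ?thesis by (rule Bochner_Integration.integrable_bound)
qed

text \<open>Integrability makes the positive and negative parts both finite, so the extended
  difference is the ordinary one.\<close>

lemma ereal_integral_ereal:
  assumes "integrable M f"
  shows "ereal_integral M (\<lambda>x. ereal (f x)) = ereal (\<integral>x. f x \<partial>M)"
proof -
  have "(\<integral>\<^sup>+x. ennreal (f x) \<partial>M) < \<infinity>" "(\<integral>\<^sup>+x. ennreal (- f x) \<partial>M) < \<infinity>"
    using assms by (auto simp: real_integrable_def less_top)
  then show ?thesis
    unfolding real_lebesgue_integral_def[OF assms] ereal_integral_def
    by (cases "\<integral>\<^sup>+x. ennreal (f x) \<partial>M"; cases "\<integral>\<^sup>+x. ennreal (- f x) \<partial>M") auto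
qed

text \<open>Covers the degenerate transforms: with total mass 1 the constant keeps its infinite
  value, and the dual objective becomes \<open>- \<infinity>\<close>, which cannot raise a
  supremum.\<close>

lemma (in prob_space) ereal_integral_infty:
  "ereal_integral M (\<lambda>_. \<infinity>) = \<infinity>" "ereal_integral M (\<lambda>_. - \<infinity>) = - \<infinity>"
  by (simp_all add: ereal_integral_def emeasure_space_1 e2ennreal_neg zero_ennreal.rep_eq)

subsection \<open>The transforms for a norm cost\<close>

lemma Q_c_le:
  assumes "is_norm N"
  shows "Q_c (\<lambda>x y. N (x - y)) \<phi> x \<le> ereal (\<phi> x)"
  unfolding Q_c_def using INF_lower[of x UNIV "\<lambda>y. ereal (\<phi> y + N (x - y))"]
  by (simp add: is_normD[OF assms])

text \<open>By the triangle inequality, moving the base point changes the cost of every competitor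
  by at most \<open>N (x - y)\<close>. The additive form stays meaningful when the transform is
  \<open>- \<infinity>\<close>.\<close>

lemma Q_c_lipschitz:
  assumes "is_norm N"
  shows "Q_c (\<lambda>x y. N (x - y)) \<phi> x \<le> Q_c (\<lambda>x y. N (x - y)) \<phi> y + ereal (N (x - y))"
proof -
  \<comment> \<open>With the finite term moved to the left, the claim is a lower bound for an
    infimum and can be checked competitor by competitor.\<close>
  have "Q_c (\<lambda>x y. N (x - y)) \<phi> x - ereal (N (x - y)) \<le> Q_c (\<lambda>x y. N (x - y)) \<phi> y"
    unfolding Q_c_def[of _ _ y]
  proof (rule INF_greatest)
    fix z
    have "Q_c (\<lambda>x y. N (x - y)) \<phi> x \<le> ereal (\<phi> z + N (x - z))"
      unfolding Q_c_def by (rule INF_lower) simp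
    also have "\<dots> \<le> ereal (\<phi> z + N (y - z)) + ereal (N (x - y))"
      using is_norm_triangle[OF assms, of x z y] by simp
    finally show "Q_c (\<lambda>x y. N (x - y)) \<phi> x - ereal (N (x - y)) \<le> ereal (\<phi> z + N (y - z))"
      by (simp add: ereal_minus_le)
  qed
  then show ?thesis by (simp add: ereal_minus_le)
qed

text \<open>The bound by \<open>\<phi>\<close> excludes \<open>\<infinity>\<close>, and
  \<open>Q_c_lipschitz\<close> spreads the value \<open>- \<infinity>\<close> from one point to all
  points.\<close>

lemma Q_c_cases:
  assumes "is_norm N"
  obtains (infinite) "Q_c (\<lambda>x y. N (x - y)) \<phi> = (\<lambda>_. - \<infinity>)"
  | (finite) q where "Q_c (\<lambda>x y. N (x - y)) \<phi> = (\<lambda>x. ereal (q x))" "lipschitz1_wrt N q"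
proof (cases "\<exists>y. Q_c (\<lambda>x y. N (x - y)) \<phi> y = - \<infinity>")
  case True
  then obtain y where "Q_c (\<lambda>x y. N (x - y)) \<phi> y = - \<infinity>" ..
  then have "Q_c (\<lambda>x y. N (x - y)) \<phi> x = - \<infinity>" for x
    using Q_c_lipschitz[OF assms, of \<phi> x y] by simp
  then show ?thesis using infinite by blast
next
  case False
  define q where "q x = real_of_ereal (Q_c (\<lambda>x y. N (x - y)) \<phi> x)" for x
  have q: "Q_c (\<lambda>x y. N (x - y)) \<phi> x = ereal (q x)" for x
    using False Q_c_le[OF assms, of \<phi> x]
    by (cases "Q_c (\<lambda>x y. N (x - y)) \<phi> x") (auto simp: q_def)
  have "q x \<le> q y + N (x - y)" for x y
    using Q_c_lipschitz[OF assms, of \<phi> x y] by (simp add: q)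
  then have "\<bar>q x - q y\<bar> \<le> N (x - y)" for x y
    using is_norm_minus_commute[OF assms, of x y] by (smt (verit))
  then show ?thesis using finite[OF ext[OF q]] by (simp add: lipschitz1_wrt_def)
qed

text \<open>The competitor \<open>y = x\<close> gives one inequality; for a 1-Lipschitz function no
  other competitor does better.\<close>

lemma Q_c_eq_self:
  assumes "is_norm N" "lipschitz1_wrt N \<phi>"
  shows "Q_c (\<lambda>x y. N (x - y)) \<phi> = (\<lambda>x. ereal (\<phi> x))"
proof
  fix x
  have "\<phi> x \<le> \<phi> y + N (x - y)" for y
    using assms(2)[unfolded lipschitz1_wrt_def, rule_format, of x y] by linarith
  then have "ereal (\<phi> x) \<le> Q_c (\<lambda>x y. N (x - y)) \<phi> x"
    unfolding Q_c_def by (intro INF_greatest) simp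
  with Q_c_le[OF assms(1), of \<phi> x] show "Q_c (\<lambda>x y. N (x - y)) \<phi> x = ereal (\<phi> x)"
    by (rule antisym)
qed

text \<open>\<open>q\<close> is the infimal convolution of \<open>\<phi>\<close> and
  \<open>N\<close>: minimising the jointly convex function \<open>\<phi> y + N (x - y)\<close> over
  \<open>y\<close> leaves a convex function of \<open>x\<close>.\<close>

lemma Q_c_convex:
  assumes N: "is_norm N" and \<phi>: "convex_on UNIV \<phi>"
    and q: "Q_c (\<lambda>x y. N (x - y)) \<phi> = (\<lambda>x. ereal (q x))"
  shows "convex_on UNIV q"
proof (rule convex_onI)
  fix t x y assume t: "(0::real) < t" "t < 1"
  show "q ((1 - t) *\<^sub>R x + t *\<^sub>R y) \<le> (1 - t) * q x + t * q y"
  \<comment> \<open>The infimum need not be attained, so \<open>e\<close>-minimisers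
    \<open>a\<close> and \<open>b\<close> for \<open>x\<close> and \<open>y\<close> are used; their
    convex combination is the competitor at the intermediate point.\<close>
  proof (rule field_le_epsilon)
    fix e :: real assume "0 < e"
    have le: "q z \<le> \<phi> a + N (z - a)" for z a
      using INF_lower[of a UNIV "\<lambda>y. ereal (\<phi> y + N (z - y))"] fun_cong[OF q, of z]
      by (simp add: Q_c_def)
    have ex: "\<exists>a. \<phi> a + N (z - a) < q z + e" for z
    proof -
      have "(INF y. ereal (\<phi> y + N (z - y))) < ereal (q z + e)"
        using fun_cong[OF q, of z] \<open>0 < e\<close> by (simp add: Q_c_def)
      then show ?thesis by (auto simp: INF_less_iff)
    qed
    obtain a b where ab: "\<phi> a + N (x - a) < q x + e" "\<phi> b + N (y - b) < q y + e"
      using ex by blast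
    have "q ((1 - t) *\<^sub>R x + t *\<^sub>R y) \<le> \<phi> ((1 - t) *\<^sub>R a + t *\<^sub>R b)
        + N ((1 - t) *\<^sub>R (x - a) + t *\<^sub>R (y - b))"
      using le[of "(1 - t) *\<^sub>R x + t *\<^sub>R y" "(1 - t) *\<^sub>R a + t *\<^sub>R b"]
      by (simp add: algebra_simps)
    also have "\<dots> \<le> ((1 - t) * \<phi> a + t * \<phi> b) + ((1 - t) * N (x - a) + t * N (y - b))"
      using convex_onD[OF \<phi>, of t a b] t is_normD(3)[OF N, of "1 - t" "x - a"]
        is_normD(3)[OF N, of t "y - b"] is_normD(4)[OF N, of "(1 - t) *\<^sub>R (x - a)" "t *\<^sub>R (y - b)"]
      by (intro add_mono) auto
    also have "\<dots> = (1 - t) * (\<phi> a + N (x - a)) + t * (\<phi> b + N (y - b))"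
      by (simp add: algebra_simps)
    also have "\<dots> \<le> (1 - t) * (q x + e) + t * (q y + e)"
      using ab t by (intro add_mono[OF mult_left_mono mult_left_mono]) auto
    also have "\<dots> = (1 - t) * q x + t * q y + e" by (simp add: algebra_simps)
    finally show "q ((1 - t) *\<^sub>R x + t *\<^sub>R y) \<le> (1 - t) * q x + t * q y + e" .
  qed
qed simp

text \<open>Carries the results on \<open>Q_c\<close> over by a change of sign, except for
  convexity: if \<open>\<psi>\<close> is convex, then \<open>- \<psi>\<close> is concave and
  \<open>Q_c_convex\<close> does not apply.\<close>

lemma Q_cbar_eq_Q_c:
  assumes "is_norm N"
  shows "Q_cbar (\<lambda>x y. N (x - y)) \<psi> y = - Q_c (\<lambda>x y. N (x - y)) (\<lambda>x. - \<psi> x) y"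
proof -
  have "Q_cbar (\<lambda>x y. N (x - y)) \<psi> y = (SUP x. - ereal (- \<psi> x + N (y - x)))"
    by (simp add: Q_cbar_def is_norm_minus_commute[OF assms, of y] algebra_simps)
  then show ?thesis by (simp only: ereal_SUP_uminus_eq Q_c_def)
qed

lemma lipschitz1_wrt_uminus: "lipschitz1_wrt N (\<lambda>x. - f x) \<longleftrightarrow> lipschitz1_wrt N f"
  by (simp add: lipschitz1_wrt_def abs_minus_commute)

lemma Q_cbar_cases:
  assumes "is_norm N"
  obtains (infinite) "Q_cbar (\<lambda>x y. N (x - y)) \<psi> = (\<lambda>_. \<infinity>)"
  | (finite) q where "Q_cbar (\<lambda>x y. N (x - y)) \<psi> = (\<lambda>x. ereal (q x))" "lipschitz1_wrt N q"
proof (cases rule: Q_c_cases[OF assms, of "\<lambda>x. - \<psi> x"])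
  case 1
  then show ?thesis using infinite by (simp add: Q_cbar_eq_Q_c[OF assms] fun_eq_iff)
next
  case (2 q)
  then show ?thesis using finite[of "\<lambda>x. - q x"]
    by (simp add: Q_cbar_eq_Q_c[OF assms] fun_eq_iff lipschitz1_wrt_uminus)
qed

lemma Q_cbar_ge:
  assumes "is_norm N"
  shows "ereal (\<psi> x) \<le> Q_cbar (\<lambda>x y. N (x - y)) \<psi> x"
  unfolding Q_cbar_def using SUP_upper[of x UNIV "\<lambda>y. ereal (\<psi> y - N (y - x))"]
  by (simp add: is_normD[OF assms])

lemma Q_cbar_eq_self:
  assumes "is_norm N" "lipschitz1_wrt N \<psi>"
  shows "Q_cbar (\<lambda>x y. N (x - y)) \<psi> = (\<lambda>x. ereal (\<psi> x))"
  using Q_c_eq_self[OF assms(1), of "\<lambda>x. - \<psi> x"] assms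
  by (simp add: Q_cbar_eq_Q_c[OF assms(1)] fun_eq_iff lipschitz1_wrt_uminus)

text \<open>Substituting \<open>x = z + a\<close> turns the transform at \<open>z\<close> into the
  supremum over \<open>a\<close> of \<open>\<psi> (z + a) - N a\<close>. For fixed \<open>a\<close>
  this is a translate of \<open>\<psi>\<close> minus a constant, and suprema of convex functions are
  convex.\<close>

lemma Q_cbar_convex:
  fixes N \<psi> q :: "'a::real_vector \<Rightarrow> real"
  assumes N: "is_norm N" and \<psi>: "convex_on UNIV \<psi>"
    and q: "Q_cbar (\<lambda>x y. N (x - y)) \<psi> = (\<lambda>x. ereal (q x))"
  shows "convex_on UNIV q"
proof (rule convex_onI)
  fix t :: real and x y :: 'a assume t: "0 < t" "t < 1"
  define m where "m = (1 - t) *\<^sub>R x + t *\<^sub>R y"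
  have le: "\<psi> (z + a) - N a \<le> q z" for z a
    using SUP_upper[of "z + a" UNIV "\<lambda>x. ereal (\<psi> x - N (x - z))"] fun_cong[OF q, of z]
    by (simp add: Q_cbar_def)
  have "ereal (q m) \<le> ereal ((1 - t) * q x + t * q y)"
    unfolding fun_cong[OF q, of m, symmetric] Q_cbar_def
  proof (rule SUP_least)
    fix b
    \<comment> \<open>The same displacement \<open>a\<close> is applied at \<open>x\<close>,
      \<open>y\<close> and \<open>m\<close>, so the cost \<open>N a\<close> is common to all
      three.\<close>
    define a where "a = b - m"
    have "b = (1 - t) *\<^sub>R (x + a) + t *\<^sub>R (y + a)"
      by (simp add: a_def m_def algebra_simps)
    then have "\<psi> b \<le> (1 - t) * \<psi> (x + a) + t * \<psi> (y + a)"
      using convex_onD[OF \<psi>, of t "x + a" "y + a"] t by simp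
    also have "\<dots> \<le> (1 - t) * (q x + N a) + t * (q y + N a)"
      using le[of x a] le[of y a] t by (intro add_mono[OF mult_left_mono mult_left_mono]) auto
    also have "\<dots> = (1 - t) * q x + t * q y + N a" by (simp add: algebra_simps)
    finally show "ereal (\<psi> b - N (b - m)) \<le> ereal ((1 - t) * q x + t * q y)"
      by (simp add: a_def)
  qed
  then show "q ((1 - t) *\<^sub>R x + t *\<^sub>R y) \<le> (1 - t) * q x + t * q y"
    by (simp add: m_def)
qed simp

subsection \<open>Existence of a maximiser\<close>

text \<open>A diagonal argument gives convergence on a countable dense set; the common Lipschitz
  bound extends it to every point.\<close>

lemma lipschitz1_wrt_convergent_subsequence:
  fixes f :: "nat \<Rightarrow> 'a::euclidean_space \<Rightarrow> real"
  assumes N: "is_norm N" and f: "\<And>n. lipschitz1_wrt N (f n)" and f0: "\<And>n. f n 0 = 0"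
  obtains k g where "strict_mono (k::nat\<Rightarrow>nat)" "\<And>x. (\<lambda>n. f (k n) x) \<longlonglongrightarrow> g x"
proof -
  obtain C where C: "0 < C" "\<And>x. N x \<le> C * norm x"
    using is_norm_le_norm[OF N] by blast
  obtain D :: "'a set" where D: "countable D" "\<And>X. open X \<Longrightarrow> X \<noteq> {} \<Longrightarrow> \<exists>d\<in>D. d \<in> X"
    using countable_dense_setE by blast
  have fN: "\<bar>f n x\<bar> \<le> N x" for n x
    using f[of n, unfolded lipschitz1_wrt_def, rule_format, of x 0] by (simp add: f0)
  \<comment> \<open>The diagonal argument requires one bound for all points, hence the division by
    \<open>N x\<close>. Where \<open>N x = 0\<close>, division by zero yields 0.\<close>
  then have "norm (f n x / N x) \<le> 1" for n x
    using is_normD(1)[OF N, of x] by (cases "N x = 0") (simp_all add: pos_divide_le_eq)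
  then obtain k :: "nat \<Rightarrow> nat" where k: "strict_mono k"
    and conv: "\<And>d. d \<in> D \<Longrightarrow> \<exists>l. (\<lambda>n. f (k n) d / N d) \<longlonglongrightarrow> l"
    using function_convergent_subsequence[OF D(1), of "\<lambda>n x. f n x / N x" 1] by blast
  have D_conv: "convergent (\<lambda>n. f (k n) d)" if "d \<in> D" for d
  proof (cases "N d = 0")
    \<comment> \<open>Here every \<open>f n\<close> vanishes at \<open>d\<close>, so the sequence is
      constant.\<close>
    case True
    then show ?thesis using fN[of _ d] by (simp add: convergent_const)
  next
    case False
    then show ?thesis
      using conv[OF that] convergent_mult_const_iff[of "N d" "\<lambda>n. f (k n) d / N d"]
      by (auto simp: convergent_def)
  qed
  have "convergent (\<lambda>n. f (k n) x)" for x
  proof (rule Cauchy_convergent, rule metric_CauchyI)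
    fix e :: real assume e: "0 < e"
    \<comment> \<open>This radius makes \<open>N (x - d) < e / 3\<close>. Passing from
      \<open>x\<close> to \<open>d\<close> for each of the two functions, and comparing them at
      \<open>d\<close>, then costs less than \<open>e / 3\<close> three times.\<close>
    then have "ball x (e / (3 * C)) \<noteq> {}" using C(1) by (simp add: not_le)
    then obtain d where d: "d \<in> D" "dist x d < e / (3 * C)"
      using D(2)[OF open_ball] by force
    then have "C * norm (x - d) < e / 3"
      using C(1) by (simp add: dist_norm field_simps)
    with C(2)[of "x - d"] have xd: "N (x - d) < e / 3" by simp
    obtain n0 where n0: "\<And>m n. n0 \<le> m \<Longrightarrow> n0 \<le> n \<Longrightarrow> dist (f (k m) d) (f (k n) d) < e / 3"
      using metric_CauchyD[OF convergent_Cauchy[OF D_conv[OF d(1)]], of "e / 3"] e by auto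
    have "dist (f (k m) x) (f (k n) x) < e" if "n0 \<le> m" "n0 \<le> n" for m n
      using n0[OF that] xd f[of "k m", unfolded lipschitz1_wrt_def, rule_format, of x d]
        f[of "k n", unfolded lipschitz1_wrt_def, rule_format, of x d]
      by (simp add: dist_real_def abs_if split: if_splits)
    then show "\<exists>M. \<forall>m\<ge>M. \<forall>n\<ge>M. dist (f (k m) x) (f (k n) x) < e" by blast
  qed
  then obtain g where "\<And>x. (\<lambda>n. f (k n) x) \<longlonglongrightarrow> g x"
    unfolding convergent_def by metis
  with k that show ?thesis by blast
qed

lemma convex_lipschitz_maximiser_exists:
  fixes \<mu> \<nu> :: "'a::euclidean_space measure"
  assumes \<mu>: "\<mu> \<in> P1" and \<nu>: "\<nu> \<in> P1" and N: "is_norm N"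
  obtains g where "convex_on UNIV g" "lipschitz1_wrt N g"
    "\<And>\<phi>. convex_on UNIV \<phi> \<Longrightarrow> lipschitz1_wrt N \<phi> \<Longrightarrow>
      (\<integral>x. \<phi> x \<partial>\<mu>) - (\<integral>x. \<phi> x \<partial>\<nu>) \<le> (\<integral>x. g x \<partial>\<mu>) - (\<integral>x. g x \<partial>\<nu>)"
proof -
  interpret \<mu>: prob_space \<mu> using \<mu> by (simp add: P1_def)
  interpret \<nu>: prob_space \<nu> using \<nu> by (simp add: P1_def)
  define J where "J \<phi> = (\<integral>x. \<phi> x \<partial>\<mu>) - (\<integral>x. \<phi> x \<partial>\<nu>)" for \<phi> :: "'a \<Rightarrow> real"
  \<comment> \<open>Fixing the value at the origin gives the common bound \<open>N\<close> on all
    competitors; without it constants could drift along a maximising sequence.\<close>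
  define A where "A = {\<phi>. convex_on UNIV \<phi> \<and> lipschitz1_wrt N \<phi> \<and> \<phi> 0 = 0}"
  have int: "integrable M \<phi>" if "M \<in> P1" "lipschitz1_wrt N \<phi>" for M \<phi>
    using integrable_C_b1[OF that(1) lipschitz1_wrt_C_b1[OF N that(2)]] .
  have absN: "\<bar>\<phi> x\<bar> \<le> N x" if "\<phi> \<in> A" for \<phi> x
  proof -
    have "lipschitz1_wrt N \<phi>" "\<phi> 0 = 0" using that by (simp_all add: A_def)
    then show ?thesis unfolding lipschitz1_wrt_def by (metis diff_zero)
  qed
  have "J \<phi> \<le> (\<integral>x. N x \<partial>\<mu>) + (\<integral>x. N x \<partial>\<nu>)" if "\<phi> \<in> A" for \<phi>
  proof -
    have lip: "lipschitz1_wrt N \<phi>" using that by (simp add: A_def)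
    have "(\<integral>x. \<phi> x \<partial>\<mu>) \<le> (\<integral>x. N x \<partial>\<mu>)"
      using absN[OF that] \<mu> lip
      by (intro integral_mono int lipschitz1_wrt_norm N) (simp_all add: abs_le_iff)
    moreover have "(\<integral>x. - \<phi> x \<partial>\<nu>) \<le> (\<integral>x. N x \<partial>\<nu>)"
      using absN[OF that] \<nu> lip
      by (intro integral_mono int lipschitz1_wrt_norm N) (simp_all add: abs_le_iff lipschitz1_wrt_uminus)
    ultimately show ?thesis by (simp add: J_def)
  qed
  \<comment> \<open>Boundedness, together with the zero function as a member of \<open>A\<close>,
    makes the real supremum \<open>s\<close> well behaved.\<close>
  then have bdd: "bdd_above (J ` A)" by (auto intro!: bdd_aboveI)
  have zero: "(\<lambda>_. 0) \<in> A"
    by (simp add: A_def convex_on_def lipschitz1_wrt_def is_normD[OF N])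
  define s where "s = (SUP \<phi>\<in>A. J \<phi>)"
  have "\<exists>\<phi>\<in>A. s - inverse (real (Suc n)) < J \<phi>" for n
    using less_cSUP_iff[OF _ bdd, of "s - inverse (real (Suc n))"] zero by (auto simp: s_def)
  then obtain f where f: "\<And>n. f n \<in> A" and sf: "\<And>n. s - inverse (real (Suc n)) < J (f n)"
    by metis
  have fs: "J (f n) \<le> s" for n
    unfolding s_def by (rule cSUP_upper[OF f bdd])
  have lim: "(\<lambda>n. J (f n)) \<longlonglongrightarrow> s"
  proof (rule real_tendsto_sandwich)
    show "(\<lambda>n. s - inverse (real (Suc n))) \<longlonglongrightarrow> s"
      using tendsto_diff[OF tendsto_const LIMSEQ_inverse_real_of_nat] by simp
    show "\<forall>\<^sub>F n in sequentially. s - inverse (real (Suc n)) \<le> J (f n)"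
      using sf by (intro always_eventually allI less_imp_le)
  qed (use fs in auto)
  obtain k g where k: "strict_mono (k::nat\<Rightarrow>nat)" and g: "\<And>x. (\<lambda>n. f (k n) x) \<longlonglongrightarrow> g x"
    using lipschitz1_wrt_convergent_subsequence[OF N, of f] f by (auto simp: A_def)
  have "\<bar>g x - g y\<bar> \<le> N (x - y)" for x y
    using f by (intro LIMSEQ_le_const2[OF tendsto_rabs[OF tendsto_diff[OF g g]]])
      (auto simp: A_def lipschitz1_wrt_def)
  then have g_lip: "lipschitz1_wrt N g" by (simp add: lipschitz1_wrt_def)
  have g_conv: "convex_on UNIV g"
  proof (rule convex_onI)
    fix t x y assume t: "(0::real) < t" "t < 1"
    show "g ((1 - t) *\<^sub>R x + t *\<^sub>R y) \<le> (1 - t) * g x + t * g y"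
    proof (rule LIMSEQ_le[OF g])
      show "(\<lambda>n. (1 - t) * f (k n) x + t * f (k n) y) \<longlonglongrightarrow> (1 - t) * g x + t * g y"
        by (intro tendsto_intros g)
      show "\<exists>M. \<forall>n\<ge>M. f (k n) ((1 - t) *\<^sub>R x + t *\<^sub>R y) \<le> (1 - t) * f (k n) x + t * f (k n) y"
        using f t by (intro exI allI impI convex_onD) (auto simp: A_def)
    qed
  qed simp
  \<comment> \<open>Every \<open>f (k n)\<close> lies in \<open>A\<close>, so \<open>N\<close>
    dominates the whole sequence.\<close>
  have int_lim: "(\<lambda>n. \<integral>x. f (k n) x \<partial>M) \<longlonglongrightarrow> (\<integral>x. g x \<partial>M)" if "M \<in> P1" for M
  proof (rule integral_dominated_convergence)
    show "integrable M N" using int[OF that lipschitz1_wrt_norm[OF N]] .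
    show "g \<in> borel_measurable M" "\<And>n. f (k n) \<in> borel_measurable M"
      using int[OF that g_lip] int[OF that, of "f (k _)"] f by (auto simp: A_def)
  qed (use g absN[OF f] in auto)
  have "(\<lambda>n. J (f (k n))) \<longlonglongrightarrow> J g"
    unfolding J_def by (intro tendsto_diff int_lim \<mu> \<nu>)
  then have Jg: "J g = s"
    using LIMSEQ_unique LIMSEQ_subseq_LIMSEQ[OF lim k, unfolded o_def] by blast
  have "J \<phi> \<le> J g" if \<phi>: "convex_on UNIV \<phi>" "lipschitz1_wrt N \<phi>" for \<phi>
  proof -
    \<comment> \<open>Subtracting \<open>\<phi> 0\<close> brings a general competitor into
      \<open>A\<close>; \<open>J\<close> does not change, because both measures have mass 1.\<close>
    have "convex_on UNIV (\<lambda>x. \<phi> x + - \<phi> 0)"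
      using \<phi>(1) by (intro convex_on_add) (simp_all add: convex_on_const)
    then have "(\<lambda>x. \<phi> x - \<phi> 0) \<in> A"
      using \<phi>(2) by (simp add: A_def lipschitz1_wrt_def)
    then have "J (\<lambda>x. \<phi> x - \<phi> 0) \<le> s"
      unfolding s_def by (rule cSUP_upper[OF _ bdd])
    then show ?thesis
      using int[OF \<mu> \<phi>(2)] int[OF \<nu> \<phi>(2)]
      by (simp add: J_def[of "\<lambda>x. \<phi> x - \<phi> 0"] J_def[of \<phi>] Jg \<mu>.prob_space \<nu>.prob_space)
  qed
  then show ?thesis unfolding J_def by (rule that[OF g_conv g_lip])
qed

subsection \<open>The dual problems\<close>

lemma D_c_below_norm_cost:
  fixes \<mu> \<nu> :: "'a::euclidean_space measure"
  assumes \<mu>: "\<mu> \<in> P1" and \<nu>: "\<nu> \<in> P1" and N: "is_norm N"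
  shows "D_c_below (\<lambda>x y. N (x - y)) \<mu> \<nu> =
    (SUP \<phi>\<in>{\<phi> \<in> convex_functions. lipschitz1_wrt N \<phi>}.
      ereal ((\<integral>x. \<phi> x \<partial>\<mu>) - (\<integral>x. \<phi> x \<partial>\<nu>)))" (is "_ = (SUP \<phi>\<in>?L. ?J \<phi>)")
proof (rule antisym)
  interpret \<mu>: prob_space \<mu> using \<mu> by (simp add: P1_def)
  note lip_int = integrable_C_b1[OF _ lipschitz1_wrt_C_b1[OF N]]
  show "D_c_below (\<lambda>x y. N (x - y)) \<mu> \<nu> \<le> (SUP \<phi>\<in>?L. ?J \<phi>)"
    unfolding D_c_below_def
  proof (rule SUP_least)
    fix \<phi> :: "'a \<Rightarrow> real" assume \<phi>: "\<phi> \<in> convex_functions \<inter> C_b1"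
    show "ereal_integral \<mu> (Q_c (\<lambda>x y. N (x - y)) \<phi>) - ereal (\<integral>x. \<phi> x \<partial>\<nu>) \<le> (SUP \<phi>\<in>?L. ?J \<phi>)"
    proof (cases rule: Q_c_cases[OF N, of \<phi>])
      case 1
      then show ?thesis by (simp add: \<mu>.ereal_integral_infty)
    next
      case (2 q)
      have "q x \<le> \<phi> x" for x
        using Q_c_le[OF N, of \<phi> x] by (simp add: 2(1))
      \<comment> \<open>Replacing \<open>\<phi>\<close> by its transform \<open>q\<close> keeps the
        integral against \<open>\<mu>\<close> and can only lower the one that is subtracted.\<close>
      then have "(\<integral>x. q x \<partial>\<nu>) \<le> (\<integral>x. \<phi> x \<partial>\<nu>)"
        using \<phi> by (intro integral_mono lip_int[OF \<nu> 2(2)] integrable_C_b1[OF \<nu>]) auto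
      then have "ereal_integral \<mu> (Q_c (\<lambda>x y. N (x - y)) \<phi>) - ereal (\<integral>x. \<phi> x \<partial>\<nu>) \<le> ?J q"
        by (simp add: 2(1) ereal_integral_ereal[OF lip_int[OF \<mu> 2(2)]])
      also have "q \<in> ?L"
        using Q_c_convex[OF N _ 2(1)] 2(2) \<phi> by (simp add: convex_functions_def)
      then have "?J q \<le> (SUP \<phi>\<in>?L. ?J \<phi>)" by (rule SUP_upper)
      finally show ?thesis .
    qed
  qed
  show "(SUP \<phi>\<in>?L. ?J \<phi>) \<le> D_c_below (\<lambda>x y. N (x - y)) \<mu> \<nu>"
    unfolding D_c_below_def
  proof (rule SUP_mono)
    \<comment> \<open>A 1-Lipschitz \<open>\<phi>\<close> is fixed by the transform, so it serves as
      its own witness with equal objective.\<close>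
    fix \<phi> assume "\<phi> \<in> ?L"
    then show "\<exists>\<phi>'\<in>convex_functions \<inter> C_b1.
        ?J \<phi> \<le> ereal_integral \<mu> (Q_c (\<lambda>x y. N (x - y)) \<phi>') - ereal (\<integral>x. \<phi>' x \<partial>\<nu>)"
      by (intro bexI[of _ \<phi>])
        (auto simp: Q_c_eq_self[OF N] ereal_integral_ereal[OF lip_int[OF \<mu>]] lipschitz1_wrt_C_b1[OF N])
  qed
qed

lemma D_c_above_norm_cost:
  fixes \<mu> \<nu> :: "'a::euclidean_space measure"
  assumes \<mu>: "\<mu> \<in> P1" and \<nu>: "\<nu> \<in> P1" and N: "is_norm N"
  shows "D_c_above (\<lambda>x y. N (x - y)) \<mu> \<nu> =
    (SUP \<phi>\<in>{\<phi> \<in> convex_functions. lipschitz1_wrt N \<phi>}.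
      ereal ((\<integral>x. \<phi> x \<partial>\<mu>) - (\<integral>x. \<phi> x \<partial>\<nu>)))" (is "_ = (SUP \<phi>\<in>?L. ?J \<phi>)")
proof (rule antisym)
  interpret \<nu>: prob_space \<nu> using \<nu> by (simp add: P1_def)
  note lip_int = integrable_C_b1[OF _ lipschitz1_wrt_C_b1[OF N]]
  show "D_c_above (\<lambda>x y. N (x - y)) \<mu> \<nu> \<le> (SUP \<phi>\<in>?L. ?J \<phi>)"
    unfolding D_c_above_def
  proof (rule SUP_least)
    fix \<psi> :: "'a \<Rightarrow> real" assume \<psi>: "\<psi> \<in> convex_functions \<inter> C_b1"
    show "ereal (\<integral>x. \<psi> x \<partial>\<mu>) - ereal_integral \<nu> (Q_cbar (\<lambda>x y. N (x - y)) \<psi>) \<le> (SUP \<phi>\<in>?L. ?J \<phi>)"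
    proof (cases rule: Q_cbar_cases[OF N, of \<psi>])
      case 1
      then show ?thesis by (simp add: \<nu>.ereal_integral_infty)
    next
      case (2 q)
      have "\<psi> x \<le> q x" for x
        using Q_cbar_ge[OF N, of \<psi> x] by (simp add: 2(1))
      \<comment> \<open>Now the transform \<open>q\<close> lies above \<open>\<psi>\<close>: the
        integral against \<open>\<nu>\<close> is kept and the one against \<open>\<mu>\<close> can
        only grow.\<close>
      then have "(\<integral>x. \<psi> x \<partial>\<mu>) \<le> (\<integral>x. q x \<partial>\<mu>)"
        using \<psi> by (intro integral_mono lip_int[OF \<mu> 2(2)] integrable_C_b1[OF \<mu>]) auto
      then have "ereal (\<integral>x. \<psi> x \<partial>\<mu>) - ereal_integral \<nu> (Q_cbar (\<lambda>x y. N (x - y)) \<psi>) \<le> ?J q"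
        by (simp add: 2(1) ereal_integral_ereal[OF lip_int[OF \<nu> 2(2)]])
      also have "q \<in> ?L"
        using Q_cbar_convex[OF N _ 2(1)] 2(2) \<psi> by (simp add: convex_functions_def)
      then have "?J q \<le> (SUP \<phi>\<in>?L. ?J \<phi>)" by (rule SUP_upper)
      finally show ?thesis .
    qed
  qed
  show "(SUP \<phi>\<in>?L. ?J \<phi>) \<le> D_c_above (\<lambda>x y. N (x - y)) \<mu> \<nu>"
    unfolding D_c_above_def
  proof (rule SUP_mono)
    fix \<phi> assume "\<phi> \<in> ?L"
    then show "\<exists>\<psi>\<in>convex_functions \<inter> C_b1.
        ?J \<phi> \<le> ereal (\<integral>x. \<psi> x \<partial>\<mu>) - ereal_integral \<nu> (Q_cbar (\<lambda>x y. N (x - y)) \<psi>)"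
      by (intro bexI[of _ \<phi>])
        (auto simp: Q_cbar_eq_self[OF N] ereal_integral_ereal[OF lip_int[OF \<nu>]] lipschitz1_wrt_C_b1[OF N])
  qed
qed

theorem theorem5:
  fixes \<mu> \<nu> :: "(real ^ 'n) measure"
    and N :: "real ^ 'n \<Rightarrow> real"
    and c :: "real ^ 'n \<Rightarrow> real ^ 'n \<Rightarrow> real"
  assumes "\<mu> \<in> P1" and "\<nu> \<in> P1"
    and "is_norm N"
    and "\<And>x y. c x y = N (x - y)"
  shows "D_c_below c \<mu> \<nu> = D_c_above c \<mu> \<nu> \<and>
    D_c_above c \<mu> \<nu> =
      (SUP \<phi>\<in>{\<phi> \<in> convex_functions. lipschitz1_wrt N \<phi>}.
         ereal ((\<integral>x. \<phi> x \<partial>\<mu>) - (\<integral>x. \<phi> x \<partial>\<nu>))) \<and>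
    (\<exists>\<phi>\<^sub>0\<in>convex_functions. lipschitz1_wrt N \<phi>\<^sub>0 \<and>
      ereal ((\<integral>x. \<phi>\<^sub>0 x \<partial>\<mu>) - (\<integral>x. \<phi>\<^sub>0 x \<partial>\<nu>)) =
      (SUP \<phi>\<in>{\<phi> \<in> convex_functions. lipschitz1_wrt N \<phi>}.
         ereal ((\<integral>x. \<phi> x \<partial>\<mu>) - (\<integral>x. \<phi> x \<partial>\<nu>))))"
proof -
  define L where "L = {\<phi> \<in> convex_functions. lipschitz1_wrt N \<phi>}"
  define J where "J \<phi> = ereal ((\<integral>x. \<phi> x \<partial>\<mu>) - (\<integral>x. \<phi> x \<partial>\<nu>))" for \<phi> :: "real ^ 'n \<Rightarrow> real"
  have c: "c = (\<lambda>x y. N (x - y))"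
    using assms(4) by (intro ext)
  obtain g where "convex_on UNIV g" "lipschitz1_wrt N g"
    "\<And>\<phi>. convex_on UNIV \<phi> \<Longrightarrow> lipschitz1_wrt N \<phi> \<Longrightarrow>
      (\<integral>x. \<phi> x \<partial>\<mu>) - (\<integral>x. \<phi> x \<partial>\<nu>) \<le> (\<integral>x. g x \<partial>\<mu>) - (\<integral>x. g x \<partial>\<nu>)"
    using convex_lipschitz_maximiser_exists[OF assms(1-3)] by blast
  then have g: "g \<in> L" "\<And>\<phi>. \<phi> \<in> L \<Longrightarrow> J \<phi> \<le> J g"
    by (simp_all add: L_def J_def convex_functions_def)
  \<comment> \<open>The maximiser turns the extended-real supremum into a value of \<open>J\<close>,
    which gives attainment.\<close>
  have "(SUP \<phi>\<in>L. J \<phi>) = J g"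
    using g by (intro antisym SUP_least SUP_upper)
  moreover have "D_c_below c \<mu> \<nu> = (SUP \<phi>\<in>L. J \<phi>)"
    unfolding L_def J_def c by (rule D_c_below_norm_cost[OF assms(1-3)])
  moreover have "D_c_above c \<mu> \<nu> = (SUP \<phi>\<in>L. J \<phi>)"
    unfolding L_def J_def c by (rule D_c_above_norm_cost[OF assms(1-3)])
  ultimately show ?thesis
    using g(1) unfolding L_def J_def by auto
qed

end
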